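(* For every finite connected weighted graph $G=(V,(c_{xy})_{x,y\in V})$, all positive site weights $\alpha=(\alpha_x)_{x\in V}$, and all non-negative site weights $\omega=(\omega_x)_{x\in V}$ with $\omega\neq 0$ (i.e., not identically zero), $${\rm gap}_{\rm SIP}(G,\alpha,\omega)={\rm gap}_{\rm RW}(G,\alpha,\omega).$$
   Context: $G=(V,(c_{xy})_{x,y\in V})$ is a finite graph with symmetric conductances $c_{xy}=c_{yx}\ge 0$, $c_{xx}=0$, connected: any two distinct sites are joined by a sequence of sites with positive conductance between consecutive ones. For $k\in\mathbb N$ let $\Xi_k=\{\eta\in\mathbb N_0^V:\sum_{x\in V}\eta_x=k\}$. The $k$-particle purely absorbing (killed) symmetric inclusion process has (sub-Markovian) generator on $\mathbb R^{\Xi_k}$ $$L_{G,\alpha,\omega,k}f(\eta)=\sum_{x,y\in V}c_{xy}\,\eta_x(\alpha_y+\eta_y)\big(f(\eta-\delta_x+\delta_y)-f(\eta)\big)-f(\eta)\sum_{x\in V}\omega_x\eta_x .$$ It is self-adjoint in $L^2(\mu_{\alpha,k})$ with $\mu_{\alpha,k}(\eta)\propto\prod_{x\in V}\frac{\Gamma(\alpha_x+\eta_x)}{\Gamma(\alpha_x)\eta_x!}$, and, when $\omega\ne0$, all eigenvalues of $-L_{G,\alpha,\omega,k}$ are strictly positive. ${\rm gap}_k(G,\alpha,\omega)$ denotes the smallest eigenvalue of $-L_{G,\alpha,\omega,k}$. Define $${\rm gap}_{\rm SIP}(G,\alpha,\omega)=\inf_{k\ge 1}{\rm gap}_k(G,\alpha,\omega),\qquad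 {\rm gap}_{\rm RW}(G,\alpha,\omega)={\rm gap}_1(G,\alpha,\omega).$$ *)

theory Defs
  imports Complex_Main
begin

text \<open>
  The sites of the graph are the elements of a finite type \<open>'v\<close>;
  the conductances are a function \<open>c\<close>.
\<close>

definition weighted_graph :: "('v::finite \<Rightarrow> 'v \<Rightarrow> real) \<Rightarrow> bool" where
  "weighted_graph c \<longleftrightarrow>
     (\<forall>x y. c x y = c y x) \<and> (\<forall>x y. c x y \<ge> 0) \<and> (\<forall>x. c x x = 0)"

definition connected_graph :: "('v::finite \<Rightarrow> 'v \<Rightarrow> real) \<Rightarrow> bool" where
  "connected_graph c \<longleftrightarrow> (\<forall>x y. x \<noteq> y \<longrightarrow> (\<lambda>u v. c u v > 0)\<^sup>*\<^sup>* x y)"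

definition configs :: "nat \<Rightarrow> ('v::finite \<Rightarrow> nat) set" where
  "configs k = {\<eta>. (\<Sum>x\<in>UNIV. \<eta> x) = k}"

text \<open>
  The configuration \<open>\<eta> - \<delta>\<^sub>x + \<delta>\<^sub>y\<close>. The subtraction truncates when \<open>\<eta> x = 0\<close>,
  but such a move has rate \<open>0\<close> in the generator.
\<close>

definition move :: "'v \<Rightarrow> 'v \<Rightarrow> ('v \<Rightarrow> nat) \<Rightarrow> 'v \<Rightarrow> nat" where
  "move x y \<eta> = (\<lambda>z. \<eta> z - of_bool (z = x) + of_bool (z = y))"

text \<open>
  One formula serves for every particle number: by \<open>sip_generator_cong\<close> below, it restricts
  to an operator on the real functions on \<open>configs k\<close>, for each \<open>k\<close>.
\<close>

definition sip_generator ::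
  "('v::finite \<Rightarrow> 'v \<Rightarrow> real) \<Rightarrow> ('v \<Rightarrow> real) \<Rightarrow> ('v \<Rightarrow> real)
     \<Rightarrow> (('v \<Rightarrow> nat) \<Rightarrow> real) \<Rightarrow> ('v \<Rightarrow> nat) \<Rightarrow> real" where
  "sip_generator c \<alpha> \<omega> f \<eta> =
     (\<Sum>x\<in>UNIV. \<Sum>y\<in>UNIV.
        c x y * real (\<eta> x) * (\<alpha> y + real (\<eta> y)) * (f (move x y \<eta>) - f \<eta>))
     - f \<eta> * (\<Sum>x\<in>UNIV. \<omega> x * real (\<eta> x))"

lemma move_in_configs:
  assumes "\<eta> \<in> configs k" and "\<eta> x \<noteq> 0"
  shows "move x y \<eta> \<in> configs k"
proof -
  have "(\<Sum>z\<in>UNIV. move x y \<eta> z) + (\<Sum>z\<in>UNIV. of_bool (z = x))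
      = (\<Sum>z\<in>UNIV. \<eta> z + of_bool (z = y))"
    unfolding sum.distrib[symmetric] using assms(2)
    by (intro sum.cong) (auto simp: move_def)
  then show ?thesis
    using assms(1) by (simp add: configs_def sum.distrib of_bool_def)
qed

lemma sip_generator_cong:
  assumes "\<And>\<xi>. \<xi> \<in> configs k \<Longrightarrow> f \<xi> = g \<xi>" and "\<eta> \<in> configs k"
  shows "sip_generator c \<alpha> \<omega> f \<eta> = sip_generator c \<alpha> \<omega> g \<eta>"
proof -
  have "c x y * real (\<eta> x) * (\<alpha> y + real (\<eta> y)) * (f (move x y \<eta>) - f \<eta>)
      = c x y * real (\<eta> x) * (\<alpha> y + real (\<eta> y)) * (g (move x y \<eta>) - g \<eta>)" for x y
    using assms move_in_configs[OF assms(2), of x y] by (cases "\<eta> x = 0") auto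
  then show ?thesis
    unfolding sip_generator_def by (simp only: assms)
qed

text \<open>
  Eigenvalues of an operator on the space of real functions on \<open>S\<close>. Elements of that space are
  represented by functions on the whole type, whose values outside \<open>S\<close> are irrelevant;
  in particular, eigenfunctions have to be nonzero somewhere on \<open>S\<close>.
\<close>

definition eigenvalue_on :: "'s set \<Rightarrow> (('s \<Rightarrow> real) \<Rightarrow> 's \<Rightarrow> real) \<Rightarrow> real \<Rightarrow> bool" where
  "eigenvalue_on S T l \<longleftrightarrow> (\<exists>f. (\<exists>s\<in>S. f s \<noteq> 0) \<and> (\<forall>s\<in>S. T f s = l * f s))"

definition gap ::
  "('v::finite \<Rightarrow> 'v \<Rightarrow> real) \<Rightarrow> ('v \<Rightarrow> real) \<Rightarrow> ('v \<Rightarrow> real) \<Rightarrow> nat \<Rightarrow> real" where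
  "gap c \<alpha> \<omega> k =
     (LEAST l. eigenvalue_on (configs k) (\<lambda>f \<eta>. - sip_generator c \<alpha> \<omega> f \<eta>) l)"

definition gap_SIP ::
  "('v::finite \<Rightarrow> 'v \<Rightarrow> real) \<Rightarrow> ('v \<Rightarrow> real) \<Rightarrow> ('v \<Rightarrow> real) \<Rightarrow> real" where
  "gap_SIP c \<alpha> \<omega> = (INF k\<in>{1..}. gap c \<alpha> \<omega> k)"

definition gap_RW ::
  "('v::finite \<Rightarrow> 'v \<Rightarrow> real) \<Rightarrow> ('v \<Rightarrow> real) \<Rightarrow> ('v \<Rightarrow> real) \<Rightarrow> real" where
  "gap_RW c \<alpha> \<omega> = gap c \<alpha> \<omega> 1"

end

theory Submission
  imports Defs "HOL-Analysis.Function_Topology"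
begin

text \<open>
  The one-particle gap dominates because a ground state for one particle produces a
  superharmonic function for any number of particles.

  With one particle, the generator is \<open>A h x = (\<Sum>y. c x y * \<alpha> y * (h y - h x)) - \<omega> x * h x\<close>.
  It is self-adjoint, so the smallest eigenvalue \<open>l\<close> of \<open>- A\<close> is the minimum of the Rayleigh quotient
  and has an eigenfunction \<open>h \<ge> 0\<close>, since the quotient does not increase when a function is replaced
  by its absolute value; connectedness of the graph makes \<open>h\<close> strictly positive
  (\<open>one_particle_ground_state\<close>).

  With \<open>k\<close> particles, consider the linear statistic \<open>F \<eta> = (\<Sum>x. \<eta> x * h x)\<close>. A jump from \<open>x\<close> to \<open>y\<close>
  changes it by \<open>h y - h x\<close>. The attractive part \<open>c x y * \<eta> x * \<eta> y\<close> of the jump rate is symmetric in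
  \<open>x\<close> and \<open>y\<close>, so it contributes nothing, and up to the killing term the particles move on average
  as if they were independent. Killing the whole configuration
  at rate \<open>\<Sum>z. \<omega> z * \<eta> z\<close> costs at least as much as killing each particle separately at its own
  rate, because a particle at \<open>x\<close> already contributes \<open>\<omega> x\<close> to the total. Hence
  \<open>L F \<le> - l * F\<close> (\<open>linear_statistic_superharmonic\<close>). As \<open>F > 0\<close>, a maximum principle for
  \<open>\<bar>g\<bar> / F\<close> shows that no eigenvalue of \<open>- L\<close> is smaller than \<open>l\<close>
  (\<open>eigenvalue_ge_of_positive_supersolution\<close>).

  That \<open>gap\<close> is an eigenvalue at all, i.e. that there is a least one for every \<open>k\<close>,
  again comes from minimising the Rayleigh quotient: the \<open>k\<close>-particle generator is
  reversible with respect to \<open>sip_weight\<close> (\<open>detailed_balance\<close>, \<open>sip_self_adjoint\<close>).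
\<close>

section \<open>The Rayleigh quotient of a self-adjoint operator\<close>

text \<open>
  Functions on \<open>S\<close> are represented by functions on the whole type, as in \<open>eigenvalue_on\<close>; the
  assumption \<open>local\<close> says that \<open>T\<close> is well defined on the represented functions. Continuity refers
  to the product topology, that is, to pointwise convergence.
\<close>

locale self_adjoint_on =
  fixes S :: "'s set" and m :: "'s \<Rightarrow> real" and T :: "('s \<Rightarrow> real) \<Rightarrow> 's \<Rightarrow> real"
  assumes finite_S: "finite S" and S_nonempty: "S \<noteq> {}"
    and m_pos: "\<And>s. s \<in> S \<Longrightarrow> m s > 0"
    and local: "\<And>f g s. (\<And>t. t \<in> S \<Longrightarrow> f t = g t) \<Longrightarrow> s \<in> S \<Longrightarrow> T f s = T g s"
    and linear: "\<And>f g a s. s \<in> S \<Longrightarrow> T (\<lambda>t. f t + a * g t) s = T f s + a * T g s"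
    and continuous: "\<And>s. s \<in> S \<Longrightarrow> continuous_on UNIV (\<lambda>f. T f s)"
    and symmetric: "\<And>f g. (\<Sum>s\<in>S. m s * f s * T g s) = (\<Sum>s\<in>S. m s * g s * T f s)"
begin

definition inner :: "('s \<Rightarrow> real) \<Rightarrow> ('s \<Rightarrow> real) \<Rightarrow> real" where
  "inner f g = (\<Sum>s\<in>S. m s * f s * g s)"

definition form :: "('s \<Rightarrow> real) \<Rightarrow> ('s \<Rightarrow> real) \<Rightarrow> real" where
  "form f g = (\<Sum>s\<in>S. m s * f s * T g s)"

lemma inner_commute: "inner f g = inner g f"
  by (simp add: inner_def mult_ac)

lemma form_commute: "form f g = form g f"
  unfolding form_def by (rule symmetric)

lemma inner_add_scaled: "inner (\<lambda>s. f s + a * g s) h = inner f h + a * inner g h"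
  by (simp add: inner_def algebra_simps sum.distrib sum_distrib_left)

lemma form_add_scaled: "form (\<lambda>s. f s + a * g s) h = form f h + a * form g h"
  by (simp add: form_def algebra_simps sum.distrib sum_distrib_left)

lemma quadratic_expansion:
  assumes "B = inner \<or> B = form"
  shows "B (\<lambda>s. f s + a * g s) (\<lambda>s. f s + a * g s) = B f f + 2 * a * B g f + a\<^sup>2 * B g g"
proof -
  have com: "B p q = B q p" for p q
    using assms inner_commute form_commute by auto
  have add: "B (\<lambda>s. p s + b * q s) r = B p r + b * B q r" for p q r b
    using assms inner_add_scaled form_add_scaled by auto
  show ?thesis
    by (simp add: add com[of _ "\<lambda>s. f s + a * g s"] com[of f g] power2_eq_square algebra_simps)
qed

lemma inner_self_pos:
  assumes "s \<in> S" and "f s \<noteq> 0"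
  shows "inner f f > 0"
proof -
  have "m t * f t * f t \<ge> 0" if "t \<in> S" for t
    using m_pos[OF that] by (simp add: mult.assoc)
  moreover have "m s * f s * f s > 0"
  proof -
    have "m s * (f s)\<^sup>2 > 0"
      using m_pos[OF assms(1)] assms(2) by simp
    then show ?thesis
      by (simp add: power2_eq_square mult.assoc)
  qed
  ultimately show ?thesis
    unfolding inner_def by (intro sum_pos2[OF finite_S assms(1)])
qed

lemma form_cong:
  assumes "\<And>s. s \<in> S \<Longrightarrow> f s = g s"
  shows "form f f = form g g"
  unfolding form_def using local[OF assms] assms by (intro sum.cong) auto

lemma scale_self:
  "inner (\<lambda>s. a * f s) (\<lambda>s. a * f s) = a\<^sup>2 * inner f f"
  "form (\<lambda>s. a * f s) (\<lambda>s. a * f s) = a\<^sup>2 * form f f"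
proof -
  have "form (\<lambda>s. 0) g = 0" "inner (\<lambda>s. 0) g = 0" for g
    by (simp_all add: form_def inner_def)
  then show "inner (\<lambda>s. a * f s) (\<lambda>s. a * f s) = a\<^sup>2 * inner f f"
      "form (\<lambda>s. a * f s) (\<lambda>s. a * f s) = a\<^sup>2 * form f f"
    using quadratic_expansion[of inner "\<lambda>s. 0" a f] inner_commute[of f "\<lambda>s. 0"]
      quadratic_expansion[of form "\<lambda>s. 0" a f] form_commute[of f "\<lambda>s. 0"]
    by simp_all
qed

text \<open>
  The normalisation bounds \<open>m s * (f s)\<^sup>2\<close> by \<open>1\<close>, so the sphere is a closed subset of a product of
  compact intervals. Fixing the value \<open>0\<close> outside \<open>S\<close> selects one representative of each function
  on \<open>S\<close>; with free values there, the set would in general not be compact.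
\<close>

lemma compact_unit_sphere: "compact {f. (\<forall>s. s \<notin> S \<longrightarrow> f s = 0) \<and> inner f f = 1}"
proof -
  define X where "X s = (if s \<in> S then {- sqrt (1 / m s)..sqrt (1 / m s)} else {0})" for s
  have "compact (Pi\<^sub>E UNIV X)"
  proof -
    have "compactin (product_topology (\<lambda>s. euclidean) UNIV) (Pi\<^sub>E UNIV X)"
      unfolding compactin_PiE by (auto simp: X_def)
    then show ?thesis
      by (simp add: euclidean_product_topology)
  qed
  moreover have "closed {f. inner f f = 1}"
    unfolding inner_def by (intro closed_Collect_eq continuous_intros) auto
  moreover have "{f. (\<forall>s. s \<notin> S \<longrightarrow> f s = 0) \<and> inner f f = 1}
      = Pi\<^sub>E UNIV X \<inter> {f. inner f f = 1}"
  proof -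
    have "f s \<in> X s" if "s \<in> S" "inner f f = 1" for f s
    proof -
      have "m s * f s * f s \<le> 1"
        using that(2) member_le_sum[OF that(1), of "\<lambda>s. m s * f s * f s"] m_pos finite_S
        by (auto simp: inner_def mult.assoc less_imp_le)
      then have "(f s)\<^sup>2 \<le> 1 / m s"
        using m_pos[OF that(1)] by (simp add: field_simps power2_eq_square)
      then have "\<bar>f s\<bar> \<le> sqrt (1 / m s)"
        by (simp add: real_le_rsqrt)
      then show ?thesis
        using that by (auto simp: X_def)
    qed
    then show ?thesis
      by (fastforce simp: X_def PiE_iff split: if_splits)
  qed
  ultimately show ?thesis
    by (simp add: compact_Int_closed)
qed

lemma rayleigh_minimiser_exists:
  obtains u l where "inner u u = 1" and "form u u = l" and "\<And>f. form f f \<ge> l * inner f f"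
proof -
  let ?K = "{f. (\<forall>s. s \<notin> S \<longrightarrow> f s = 0) \<and> inner f f = 1}"
  \<comment> \<open>By homogeneity it suffices to minimise over the unit sphere.\<close>
  have normalise: "\<exists>g\<in>?K. form f f = inner f f * form g g" if "s \<in> S" "f s \<noteq> 0" for f s
  proof -
    define a where "a = 1 / sqrt (inner f f)"
    define g where "g = (\<lambda>s. if s \<in> S then a * f s else 0)"
    have pos: "inner f f > 0"
      by (rule inner_self_pos[of s f]) (use that in auto)
    then have a2: "a\<^sup>2 * inner f f = 1"
      by (simp add: a_def power_divide)
    have "inner g g = inner (\<lambda>s. a * f s) (\<lambda>s. a * f s)"
      unfolding inner_def g_def by (intro sum.cong) auto
    moreover have "form g g = form (\<lambda>s. a * f s) (\<lambda>s. a * f s)"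
      by (rule form_cong) (simp add: g_def)
    ultimately have "g \<in> ?K" "inner f f * form g g = form f f"
      using a2 by (auto simp: scale_self g_def algebra_simps)
    then show ?thesis
      by (intro bexI[of _ g]) simp_all
  qed
  have "?K \<noteq> {}"
  proof -
    obtain s where "s \<in> S"
      using S_nonempty by blast
    then obtain g where "g \<in> ?K"
      using normalise[of s "\<lambda>s. 1"] by auto
    then show ?thesis
      by blast
  qed
  moreover have "continuous_on ?K (\<lambda>f. form f f)"
  proof -
    have "continuous_on ?K (\<lambda>f. T f s)" if "s \<in> S" for s
      using continuous[OF that] continuous_on_subset by blast
    moreover have "continuous_on ?K (\<lambda>f. f s)" for s
      by (rule continuous_on_subset[OF continuous_on_product_coordinates]) auto
    ultimately show ?thesis
      unfolding form_def by (intro continuous_on_sum continuous_on_mult continuous_on_const)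
  qed
  ultimately obtain u where u: "u \<in> ?K" "\<And>g. g \<in> ?K \<Longrightarrow> form u u \<le> form g g"
    using continuous_attains_inf[OF compact_unit_sphere, of "\<lambda>f. form f f"] by blast
  have "form f f \<ge> form u u * inner f f" for f
  proof (cases "\<exists>s\<in>S. f s \<noteq> 0")
    case True
    then obtain g where g: "g \<in> ?K" "form f f = inner f f * form g g"
      using normalise by blast
    have "inner f f \<ge> 0"
      using True inner_self_pos less_imp_le by blast
    then show ?thesis
      using g u(2) by (simp add: mult.commute mult_left_mono)
  next
    case False
    then show ?thesis
      by (simp add: form_def inner_def)
  qed
  then show ?thesis
    using that u(1) by blast
qed

text \<open>
  First variation: perturbing the minimiser by a multiple of the point mass at \<open>s\<close> gives the
  eigenvalue equation at \<open>s\<close>.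
\<close>

lemma rayleigh_minimiser_is_eigenfunction:
  assumes min: "\<And>f. form f f \<ge> l * inner f f" and eq: "form u u = l * inner u u"
    and s: "s \<in> S"
  shows "T u s = l * u s"
proof -
  define d where "d t = (of_bool (t = s) :: real)" for t :: 's
  define p where "p = form d u - l * inner d u"
  define q where "q = form d d - l * inner d d"
  have "0 \<le> 2 * a * p + a\<^sup>2 * q" for a
    using min[of "\<lambda>t. u t + a * d t"] eq quadratic_expansion[of form u a d]
      quadratic_expansion[of inner u a d]
    by (simp add: p_def q_def algebra_simps)
  \<comment> \<open>A quadratic polynomial \<open>2 * a * p + a\<^sup>2 * q\<close> that is nowhere negative has \<open>p = 0\<close>: otherwise the
    linear term wins at \<open>a = - p / (\<bar>q\<bar> + 1)\<close>.\<close>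
  then have "0 \<le> 2 * (- p / (\<bar>q\<bar> + 1)) * p + (- p / (\<bar>q\<bar> + 1))\<^sup>2 * q"
    by blast
  also have "\<dots> = (p / (\<bar>q\<bar> + 1))\<^sup>2 * (q - 2 * (\<bar>q\<bar> + 1))"
  proof -
    have "D > 0 \<Longrightarrow> 2 * (- p / D) * p + (- p / D)\<^sup>2 * q = (p / D)\<^sup>2 * (q - 2 * D)" for D
      by (simp add: field_simps power2_eq_square)
    then show ?thesis
      by simp
  qed
  finally have "0 \<le> (p / (\<bar>q\<bar> + 1))\<^sup>2 * (q - 2 * (\<bar>q\<bar> + 1))" .
  moreover have "q - 2 * (\<bar>q\<bar> + 1) < 0"
    using abs_ge_self[of q] by argo
  ultimately have "(p / (\<bar>q\<bar> + 1))\<^sup>2 \<le> 0"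
    unfolding zero_le_mult_iff by linarith
  then have "p = 0"
    by (simp add: add_nonneg_eq_0_iff)
  moreover have "form d u = m s * T u s" "inner d u = m s * u s"
    using finite_S s by (simp_all add: form_def inner_def d_def of_bool_def if_distrib cong: if_cong)
      (simp_all add: sum.remove[of S s])
  ultimately show ?thesis
    using m_pos[OF s] by (simp add: p_def)
qed

text \<open>
  If taking absolute values does not increase the quadratic form, the absolute value of a minimiser
  is again a minimiser, hence a nonnegative eigenfunction.
\<close>

lemma ground_state:
  assumes abs: "\<And>f. form (\<lambda>s. \<bar>f s\<bar>) (\<lambda>s. \<bar>f s\<bar>) \<le> form f f"
  obtains u where "\<And>s. u s \<ge> 0" and "\<exists>s\<in>S. u s \<noteq> 0"
    and "\<And>s. s \<in> S \<Longrightarrow> T u s = (LEAST l. eigenvalue_on S T l) * u s"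
    and "eigenvalue_on S T (LEAST l. eigenvalue_on S T l)"
proof -
  obtain v l where v: "inner v v = 1" "form v v = l" and min: "\<And>f. form f f \<ge> l * inner f f"
    using rayleigh_minimiser_exists by blast
  define u where "u = (\<lambda>s. \<bar>v s\<bar>)"
  have inner_u: "inner u u = 1"
    using v(1) by (simp add: inner_def u_def mult.assoc)
  then have "form u u = l * inner u u"
    using abs[of v] min[of u] v by (simp add: u_def)
  then have Tu: "T u s = l * u s" if "s \<in> S" for s
    using rayleigh_minimiser_is_eigenfunction[OF min] that by blast
  have nz: "\<exists>s\<in>S. u s \<noteq> 0"
  proof (rule ccontr)
    assume "\<not> (\<exists>s\<in>S. u s \<noteq> 0)"
    then have "inner u u = 0"
      by (simp add: inner_def)
    then show False
      using inner_u by simp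
  qed
  have "(LEAST l. eigenvalue_on S T l) = l"
  proof (rule Least_equality)
    show "eigenvalue_on S T l"
      using Tu nz by (auto simp: eigenvalue_on_def)
  next
    fix r
    assume "eigenvalue_on S T r"
    then obtain f where f: "\<exists>s\<in>S. f s \<noteq> 0" "\<And>s. s \<in> S \<Longrightarrow> T f s = r * f s"
      by (auto simp: eigenvalue_on_def)
    have "form f f = r * inner f f"
      using f(2) by (simp add: form_def inner_def sum_distrib_left mult_ac)
    moreover have "inner f f > 0"
      using f(1) inner_self_pos by blast
    ultimately show "l \<le> r"
      using min[of f] by simp
  qed
  moreover have "u s \<ge> 0" for s
    by (simp add: u_def)
  moreover have "eigenvalue_on S T l"
    using Tu nz by (auto simp: eigenvalue_on_def)
  ultimately show ?thesis
    using that[of u] Tu nz by simp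
qed

end

section \<open>Reversibility of the inclusion process\<close>

text \<open>
  The reversible measure \<open>\<mu>\<close>, without normalisation: \<open>pochhammer a n\<close> is
  \<open>\<Gamma>(a + n) / \<Gamma>(a)\<close>.
\<close>

definition sip_weight :: "('v::finite \<Rightarrow> real) \<Rightarrow> ('v \<Rightarrow> nat) \<Rightarrow> real" where
  "sip_weight \<alpha> \<eta> = (\<Prod>x\<in>UNIV. pochhammer (\<alpha> x) (\<eta> x) / fact (\<eta> x))"

lemma sip_weight_pos:
  assumes "\<And>x. \<alpha> x > 0"
  shows "sip_weight \<alpha> \<eta> > 0"
  unfolding sip_weight_def using assms by (intro prod_pos) (simp add: pochhammer_pos)

text \<open>
  Only the factors at \<open>x\<close> and \<open>y\<close> change in a jump. For a single factor
  \<open>w a n = pochhammer a n / fact n\<close> one has \<open>w a (Suc n) * Suc n = w a n * (a + n)\<close>, which is used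
  from left to right at \<open>x\<close> and from right to left at \<open>y\<close>.
\<close>

lemma detailed_balance:
  assumes "x \<noteq> y" and "\<eta> x \<noteq> 0"
  shows "sip_weight \<alpha> \<eta> * (real (\<eta> x) * (\<alpha> y + real (\<eta> y)))
    = sip_weight \<alpha> (move x y \<eta>)
      * (real (move x y \<eta> y) * (\<alpha> x + real (move x y \<eta> x)))"
proof -
  define w where "w a n = pochhammer a n / fact n" for a :: real and n
  define R where "R = (\<Prod>z\<in>UNIV - {x} - {y}. w (\<alpha> z) (\<eta> z))"
  have w_Suc: "w a (Suc n) * real (Suc n) = w a n * (a + real n)" for a n
    by (simp add: w_def pochhammer_Suc)
  have split: "sip_weight \<alpha> \<xi> = w (\<alpha> x) (\<xi> x) * (w (\<alpha> y) (\<xi> y)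
      * (\<Prod>z\<in>UNIV - {x} - {y}. w (\<alpha> z) (\<xi> z)))" for \<xi>
    unfolding sip_weight_def w_def using assms(1)
    by (subst prod.remove[of UNIV x], simp, simp, subst prod.remove[of "UNIV - {x}" y]) auto
  obtain n where n: "\<eta> x = Suc n"
    using assms(2) not0_implies_Suc by blast
  have mv: "move x y \<eta> x = n" "move x y \<eta> y = Suc (\<eta> y)"
    using assms n by (auto simp: move_def)
  have R': "(\<Prod>z\<in>UNIV - {x} - {y}. w (\<alpha> z) (move x y \<eta> z)) = R"
    unfolding R_def by (intro prod.cong) (auto simp: move_def)
  have "sip_weight \<alpha> \<eta> * (real (\<eta> x) * (\<alpha> y + real (\<eta> y)))
      = (w (\<alpha> x) (Suc n) * real (Suc n)) * (w (\<alpha> y) (\<eta> y) * (\<alpha> y + real (\<eta> y))) * R"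
    unfolding split[of \<eta>] R_def[symmetric] n by (simp only: mult_ac)
  also have "\<dots> = (w (\<alpha> x) n * (\<alpha> x + real n))
      * (w (\<alpha> y) (Suc (\<eta> y)) * real (Suc (\<eta> y))) * R"
    by (simp only: w_Suc)
  also have "\<dots> = sip_weight \<alpha> (move x y \<eta>)
      * (real (move x y \<eta> y) * (\<alpha> x + real (move x y \<eta> x)))"
    unfolding split[of "move x y \<eta>"] R' mv by (simp only: mult_ac)
  finally show ?thesis .
qed

lemma finite_configs: "finite (configs k :: ('v::finite \<Rightarrow> nat) set)"
proof -
  have "\<eta> x \<le> k" if "\<eta> \<in> configs k" for \<eta> :: "'v \<Rightarrow> nat" and x
    using that member_le_sum[of x UNIV \<eta>] by (simp add: configs_def)
  then have "configs k \<subseteq> (PiE UNIV (\<lambda>_. {..k}) :: ('v \<Rightarrow> nat) set)"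
    by auto
  then show ?thesis
    by (rule finite_subset) (simp add: finite_PiE)
qed

lemma move_move_back:
  assumes "\<eta> x \<noteq> 0" and "x \<noteq> y"
  shows "move y x (move x y \<eta>) = \<eta>"
  using assms by (auto simp: move_def fun_eq_iff)

lemma move_target_pos: "move x y \<eta> y > 0"
  by (simp add: move_def)

text \<open>
  Detailed balance in summed form, by the substitution \<open>\<eta> \<mapsto> move x y \<eta>\<close>. It is a bijection only
  between the configurations with a particle at \<open>x\<close> and those with a particle at \<open>y\<close>; the rates
  vanish on the others, where \<open>move\<close> truncates.
\<close>

lemma jump_sum_symmetric:
  assumes "x \<noteq> y"
  shows "(\<Sum>\<eta>\<in>configs k. sip_weight \<alpha> \<eta> * (real (\<eta> x) * (\<alpha> y + real (\<eta> y)))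
          * (f \<eta> * g (move x y \<eta>)))
       = (\<Sum>\<eta>\<in>configs k. sip_weight \<alpha> \<eta> * (real (\<eta> y) * (\<alpha> x + real (\<eta> x)))
          * (g \<eta> * f (move y x \<eta>)))" (is "sum ?F _ = sum ?G _")
proof -
  let ?C = "\<lambda>z. {\<eta> \<in> configs k. \<eta> z \<noteq> 0}"
  have "sum ?F (configs k) = sum ?F (?C x)"
    by (rule sum.mono_neutral_right) (auto simp: finite_configs)
  also have "\<dots> = sum ?G (?C y)"
  proof (rule sum.reindex_bij_witness[of _ "move y x" "move x y"])
    fix \<eta>
    assume \<eta>: "\<eta> \<in> ?C x"
    show "move y x (move x y \<eta>) = \<eta>"
      using move_move_back[of \<eta> x y] \<eta> assms by auto
    show "move x y \<eta> \<in> ?C y"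
      using \<eta> move_in_configs[of \<eta> k x y] by (simp add: move_target_pos)
    show "?G (move x y \<eta>) = ?F \<eta>"
      using \<eta> assms by (simp add: move_move_back detailed_balance[OF assms, of \<eta> \<alpha>])
  next
    fix \<eta>
    assume \<eta>: "\<eta> \<in> ?C y"
    show "move x y (move y x \<eta>) = \<eta>"
      using move_move_back[of \<eta> y x] \<eta> assms by auto
    show "move y x \<eta> \<in> ?C x"
      using \<eta> move_in_configs[of \<eta> k y x] by (simp add: move_target_pos)
  qed
  also have "\<dots> = sum ?G (configs k)"
    by (rule sum.mono_neutral_left) (auto simp: finite_configs)
  finally show ?thesis .
qed

text \<open>
  The bilinear form splits into a diagonal part, obviously symmetric and unchanged when \<open>f = g\<close> is
  replaced by its absolute value, and the jump sums treated in \<open>jump_sum_symmetric\<close>.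
\<close>

lemma sip_form_expand:
  "(\<Sum>\<eta>\<in>configs k. sip_weight \<alpha> \<eta> * f \<eta> * - sip_generator c \<alpha> \<omega> g \<eta>)
   = (\<Sum>\<eta>\<in>configs k. sip_weight \<alpha> \<eta> * (f \<eta> * g \<eta>)
        * ((\<Sum>x\<in>UNIV. \<Sum>y\<in>UNIV. c x y * real (\<eta> x) * (\<alpha> y + real (\<eta> y)))
           + (\<Sum>x\<in>UNIV. \<omega> x * real (\<eta> x))))
     - (\<Sum>x\<in>UNIV. \<Sum>y\<in>UNIV. c x y * (\<Sum>\<eta>\<in>configs k.
          sip_weight \<alpha> \<eta> * (real (\<eta> x) * (\<alpha> y + real (\<eta> y))) * (f \<eta> * g (move x y \<eta>))))"
proof -
  have "(\<Sum>x\<in>UNIV. \<Sum>y\<in>UNIV. c x y * (\<Sum>\<eta>\<in>configs k.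
          sip_weight \<alpha> \<eta> * (real (\<eta> x) * (\<alpha> y + real (\<eta> y))) * (f \<eta> * g (move x y \<eta>))))
     = (\<Sum>x\<in>UNIV. \<Sum>\<eta>\<in>configs k. \<Sum>y\<in>UNIV. c x y * (
          sip_weight \<alpha> \<eta> * (real (\<eta> x) * (\<alpha> y + real (\<eta> y))) * (f \<eta> * g (move x y \<eta>))))"
    by (subst (2) sum.swap) (simp add: sum_distrib_left)
  also have "\<dots> = (\<Sum>\<eta>\<in>configs k. \<Sum>x\<in>UNIV. \<Sum>y\<in>UNIV. c x y * (
          sip_weight \<alpha> \<eta> * (real (\<eta> x) * (\<alpha> y + real (\<eta> y))) * (f \<eta> * g (move x y \<eta>))))"
    by (rule sum.swap)
  finally have *: "(\<Sum>x\<in>UNIV. \<Sum>y\<in>UNIV. c x y * (\<Sum>\<eta>\<in>configs k.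
          sip_weight \<alpha> \<eta> * (real (\<eta> x) * (\<alpha> y + real (\<eta> y))) * (f \<eta> * g (move x y \<eta>)))) = \<dots>" .
  show ?thesis
    unfolding * sum_subtractf[symmetric] sip_generator_def
    by (intro sum.cong)
      (simp_all add: algebra_simps sum_subtractf sum.distrib sum_distrib_left)
qed

lemma sip_self_adjoint:
  fixes c :: "'v::finite \<Rightarrow> 'v \<Rightarrow> real"
  assumes c: "weighted_graph c" and \<alpha>: "\<And>x. \<alpha> x > 0"
  shows "self_adjoint_on (configs k) (sip_weight \<alpha>) (\<lambda>f \<eta>. - sip_generator c \<alpha> \<omega> f \<eta>)"
proof
  show "finite (configs k :: ('v \<Rightarrow> nat) set)"
    by (rule finite_configs)
  have "(\<lambda>z. k * of_bool (z = undefined)) \<in> (configs k :: ('v \<Rightarrow> nat) set)"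
    by (simp add: configs_def of_bool_def if_distrib cong: if_cong)
  then show "(configs k :: ('v \<Rightarrow> nat) set) \<noteq> {}"
    by blast
next
  show "sip_weight \<alpha> s > 0" for s
    using sip_weight_pos \<alpha> by blast
next
  show "- sip_generator c \<alpha> \<omega> f s = - sip_generator c \<alpha> \<omega> g s"
    if "\<And>t. t \<in> configs k \<Longrightarrow> f t = g t" "s \<in> configs k" for f g s
    using sip_generator_cong[OF that] by simp
next
  show "- sip_generator c \<alpha> \<omega> (\<lambda>t. f t + a * g t) s
      = - sip_generator c \<alpha> \<omega> f s + a * - sip_generator c \<alpha> \<omega> g s" for f g a s
    unfolding sip_generator_def
    by (simp add: algebra_simps sum_subtractf sum.distrib sum_distrib_left)
next
  show "continuous_on UNIV (\<lambda>f. - sip_generator c \<alpha> \<omega> f s)" for s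
    unfolding sip_generator_def by (intro continuous_intros) auto
next
  fix f g :: "('v \<Rightarrow> nat) \<Rightarrow> real"
  let ?J = "\<lambda>f g x y. c x y * (\<Sum>\<eta>\<in>configs k.
      sip_weight \<alpha> \<eta> * (real (\<eta> x) * (\<alpha> y + real (\<eta> y))) * (f \<eta> * g (move x y \<eta>)))"
  have "?J f g x y = ?J g f y x" for x y
  proof (cases "x = y")
    case True
    then show ?thesis
      using c by (simp add: weighted_graph_def)
  next
    case False
    moreover have "c x y = c y x"
      using c by (simp add: weighted_graph_def)
    ultimately show ?thesis
      using jump_sum_symmetric[OF False, of \<alpha> f g k] by simp
  qed
  then have "(\<Sum>x\<in>UNIV. \<Sum>y\<in>UNIV. ?J f g x y) = (\<Sum>x\<in>UNIV. \<Sum>y\<in>UNIV. ?J g f y x)"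
    by (simp only:)
  also have "\<dots> = (\<Sum>x\<in>UNIV. \<Sum>y\<in>UNIV. ?J g f x y)"
    by (rule sum.swap)
  finally show "(\<Sum>s\<in>configs k. sip_weight \<alpha> s * f s * - sip_generator c \<alpha> \<omega> g s)
      = (\<Sum>s\<in>configs k. sip_weight \<alpha> s * g s * - sip_generator c \<alpha> \<omega> f s)"
    unfolding sip_form_expand by (simp add: mult.commute[of "f _" "g _"])
qed

lemma sip_ground_state:
  fixes c :: "'v::finite \<Rightarrow> 'v \<Rightarrow> real"
  assumes c: "weighted_graph c" and \<alpha>: "\<And>x. \<alpha> x > 0"
  obtains u where "\<And>\<eta>. u \<eta> \<ge> 0" and "\<exists>\<eta>\<in>configs k. u \<eta> \<noteq> 0"
    and "\<And>\<eta>. \<eta> \<in> configs k \<Longrightarrow> - sip_generator c \<alpha> \<omega> u \<eta> = gap c \<alpha> \<omega> k * u \<eta>"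
    and "eigenvalue_on (configs k) (\<lambda>f \<eta>. - sip_generator c \<alpha> \<omega> f \<eta>) (gap c \<alpha> \<omega> k)"
proof -
  interpret self_adjoint_on "configs k" "sip_weight \<alpha>" "\<lambda>f \<eta>. - sip_generator c \<alpha> \<omega> f \<eta>"
    using c \<alpha> by (rule sip_self_adjoint)
  have "form (\<lambda>s. \<bar>f s\<bar>) (\<lambda>s. \<bar>f s\<bar>) \<le> form f f" for f
    unfolding form_def sip_form_expand abs_mult_self_eq
  proof (intro diff_left_mono sum_mono mult_left_mono)
    show "f \<eta> * f (move x y \<eta>) \<le> \<bar>f \<eta>\<bar> * \<bar>f (move x y \<eta>)\<bar>" for \<eta> x y
      by (metis abs_ge_self abs_mult)
    show "0 \<le> sip_weight \<alpha> \<eta> * (real (\<eta> x) * (\<alpha> y + real (\<eta> y)))" for \<eta> x y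
      using sip_weight_pos[of \<alpha> \<eta>] \<alpha> by (simp add: add_nonneg_nonneg less_imp_le)
    show "0 \<le> c x y" for x y
      using c by (simp add: weighted_graph_def)
  qed
  from ground_state[OF this] show ?thesis
    using that unfolding gap_def by blast
qed

section \<open>The one-particle ground state\<close>

definition single :: "'v \<Rightarrow> 'v \<Rightarrow> nat" where
  "single x = (\<lambda>z. of_bool (z = x))"

lemma single_in_configs: "single x \<in> configs 1"
  by (simp add: configs_def single_def of_bool_def)

lemma configs_1_single:
  fixes \<eta> :: "'v::finite \<Rightarrow> nat"
  assumes "\<eta> \<in> configs 1"
  obtains x where "\<eta> = single x"
proof -
  have "(\<Sum>x\<in>UNIV. \<eta> x) = 1"
    using assms by (simp add: configs_def)
  then obtain x where "\<eta> x = 1" "\<And>y. y \<noteq> x \<Longrightarrow> \<eta> y = 0"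
    by (subst (asm) sum_eq_1_iff) auto
  then have "\<eta> = single x"
    by (auto simp: single_def)
  then show ?thesis
    using that by blast
qed

lemma sip_generator_single:
  assumes "weighted_graph c"
  shows "sip_generator c \<alpha> \<omega> f (single x)
    = (\<Sum>y\<in>UNIV. c x y * \<alpha> y * (f (single y) - f (single x))) - \<omega> x * f (single x)"
proof -
  have jump: "c x y * (\<alpha> y + real (single x y)) * (f (move x y (single x)) - f (single x))
      = c x y * \<alpha> y * (f (single y) - f (single x))" for y
  proof (cases "x = y")
    case True
    then show ?thesis
      using assms by (simp add: weighted_graph_def)
  next
    case False
    then have "move x y (single x) = single y"
      by (auto simp: move_def single_def)
    then show ?thesis
      using False by (simp add: single_def)
  qed
  have only: "(\<Sum>z\<in>UNIV. real (single x z) * F z) = F x" for F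
    by (simp add: single_def of_bool_def if_distrib if_distribR cong: if_cong)
  have "sip_generator c \<alpha> \<omega> f (single x)
    = (\<Sum>z\<in>UNIV. real (single x z)
         * (\<Sum>y\<in>UNIV. c z y * (\<alpha> y + real (single x y)) * (f (move z y (single x)) - f (single x))))
      - f (single x) * (\<Sum>z\<in>UNIV. real (single x z) * \<omega> z)"
    by (simp add: sip_generator_def sum_distrib_left mult_ac)
  then show ?thesis
    by (simp add: only jump)
qed

text \<open>
  Strict positivity is the Perron-Frobenius argument: a zero of a nonnegative eigenfunction would
  propagate through the connected graph.
\<close>

lemma one_particle_ground_state:
  fixes c :: "'v::finite \<Rightarrow> 'v \<Rightarrow> real"
  assumes c: "weighted_graph c" and conn: "connected_graph c" and \<alpha>: "\<And>x. \<alpha> x > 0"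
  obtains h where "\<And>x. h x > 0"
    and "\<And>x. (\<Sum>y\<in>UNIV. c x y * \<alpha> y * (h y - h x)) - \<omega> x * h x = - gap_RW c \<alpha> \<omega> * h x"
proof -
  obtain u where u: "\<And>\<eta>. u \<eta> \<ge> 0" "\<exists>\<eta>\<in>configs 1. u \<eta> \<noteq> 0"
    "\<And>\<eta>. \<eta> \<in> configs 1 \<Longrightarrow> - sip_generator c \<alpha> \<omega> u \<eta> = gap c \<alpha> \<omega> 1 * u \<eta>"
    by (rule sip_ground_state[where \<alpha> = \<alpha> and k = 1 and \<omega> = \<omega>, OF c \<alpha>]) (rule that; assumption)
  define h where "h x = u (single x)" for x
  have eigen: "(\<Sum>y\<in>UNIV. c x y * \<alpha> y * (h y - h x)) - \<omega> x * h x = - gap_RW c \<alpha> \<omega> * h x" for x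
    using u(3)[OF single_in_configs[of x]]
    by (simp add: sip_generator_single[OF c] h_def gap_RW_def)
  \<comment> \<open>At a zero of \<open>h\<close> the eigenvalue equation says that a weighted sum of the nonnegative values
    at the neighbours vanishes, so zeros spread along edges.\<close>
  have spread: "h y = 0" if "h x = 0" "c x y > 0" for x y
  proof -
    have "(\<Sum>y\<in>UNIV. c x y * \<alpha> y * h y) = 0"
      using eigen[of x] that(1) by simp
    moreover have "c x y * \<alpha> y * h y \<ge> 0" for y
      using c \<alpha>[of y] u(1) by (simp add: weighted_graph_def h_def)
    ultimately have "c x y * \<alpha> y * h y = 0"
      by (subst (asm) sum_nonneg_eq_0_iff) auto
    then show ?thesis
      using that(2) \<alpha>[of y] by simp
  qed
  have "h x > 0" for x
  proof (rule ccontr)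
    assume "\<not> h x > 0"
    then have "h x = 0"
      using u(1)[of "single x"] by (simp add: h_def)
    have "h y = 0" for y
    proof (cases "x = y")
      case False
      then have "(\<lambda>u v. c u v > 0)\<^sup>*\<^sup>* x y"
        using conn by (simp add: connected_graph_def)
      then show ?thesis
        using \<open>h x = 0\<close> by induction (auto intro: spread)
    qed (use \<open>h x = 0\<close> in simp)
    then show False
      using u(2) configs_1_single by (metis h_def)
  qed
  then show ?thesis
    using that eigen by blast
qed

section \<open>Comparison of many particles with one\<close>

lemma sum_antisymmetric_eq_0:
  fixes F :: "'a::finite \<Rightarrow> 'a \<Rightarrow> real"
  assumes "\<And>x y. F x y = - F y x"
  shows "(\<Sum>x\<in>UNIV. \<Sum>y\<in>UNIV. F x y) = 0"
proof -
  have "(\<Sum>x\<in>UNIV. \<Sum>y\<in>UNIV. F x y) = (\<Sum>x\<in>UNIV. \<Sum>y\<in>UNIV. F y x)"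
    by (rule sum.swap)
  also have "\<dots> = - (\<Sum>x\<in>UNIV. \<Sum>y\<in>UNIV. F x y)"
    by (subst assms) (simp add: sum_negf)
  finally show ?thesis
    by simp
qed

lemma linear_statistic_move:
  fixes h :: "'v::finite \<Rightarrow> real"
  assumes "\<eta> x \<noteq> 0"
  shows "(\<Sum>z\<in>UNIV. real (move x y \<eta> z) * h z) = (\<Sum>z\<in>UNIV. real (\<eta> z) * h z) + (h y - h x)"
proof -
  have "real (move x y \<eta> z) * h z
      = real (\<eta> z) * h z + (if z = y then h z else 0) - (if z = x then h z else 0)" for z
    using assms by (auto simp: move_def algebra_simps of_nat_diff)
  then show ?thesis
    by (simp add: sum.distrib sum_subtractf)
qed

text \<open>
  The interaction drops out because \<open>c x y * \<eta> x * \<eta> y * (h y - h x)\<close> is antisymmetric in \<open>x\<close> and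
  \<open>y\<close>. By the eigenvalue equation for \<open>h\<close>, what remains is \<open>- l * F \<eta>\<close> plus
  \<open>\<Sum>x. \<eta> x * h x * (\<omega> x - (\<Sum>z. \<omega> z * \<eta> z))\<close>, and no summand is positive: if \<open>\<eta> x \<ge> 1\<close> then
  the total killing rate is at least \<open>\<omega> x\<close>.
\<close>

lemma linear_statistic_superharmonic:
  fixes c :: "'v::finite \<Rightarrow> 'v \<Rightarrow> real"
  assumes c: "weighted_graph c" and \<omega>: "\<And>x. \<omega> x \<ge> 0" and h: "\<And>x. h x > 0"
    and eigen: "\<And>x. (\<Sum>y\<in>UNIV. c x y * \<alpha> y * (h y - h x)) - \<omega> x * h x = - l * h x"
  defines "F \<equiv> \<lambda>\<eta>. \<Sum>x\<in>UNIV. real (\<eta> x) * h x"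
  shows "sip_generator c \<alpha> \<omega> F \<eta> \<le> - l * F \<eta>"
proof -
  have "(\<Sum>x\<in>UNIV. \<Sum>y\<in>UNIV. c x y * real (\<eta> x) * (\<alpha> y + real (\<eta> y)) * (F (move x y \<eta>) - F \<eta>))
      = (\<Sum>x\<in>UNIV. \<Sum>y\<in>UNIV. c x y * real (\<eta> x) * (\<alpha> y + real (\<eta> y)) * (h y - h x))"
  proof (intro sum.cong refl)
    fix x y
    show "c x y * real (\<eta> x) * (\<alpha> y + real (\<eta> y)) * (F (move x y \<eta>) - F \<eta>)
        = c x y * real (\<eta> x) * (\<alpha> y + real (\<eta> y)) * (h y - h x)"
      by (cases "\<eta> x = 0") (simp_all add: F_def linear_statistic_move)
  qed
  also have "\<dots> = (\<Sum>x\<in>UNIV. \<Sum>y\<in>UNIV. c x y * real (\<eta> x) * \<alpha> y * (h y - h x))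
      + (\<Sum>x\<in>UNIV. \<Sum>y\<in>UNIV. c x y * real (\<eta> x) * real (\<eta> y) * (h y - h x))"
    by (simp add: algebra_simps sum.distrib sum_subtractf)
  also have "(\<Sum>x\<in>UNIV. \<Sum>y\<in>UNIV. c x y * real (\<eta> x) * real (\<eta> y) * (h y - h x)) = 0"
  proof (rule sum_antisymmetric_eq_0)
    fix x y
    have "c x y = c y x"
      using c by (simp add: weighted_graph_def)
    then show "c x y * real (\<eta> x) * real (\<eta> y) * (h y - h x)
        = - (c y x * real (\<eta> y) * real (\<eta> x) * (h x - h y))"
      by (simp add: algebra_simps)
  qed
  also have "(\<Sum>x\<in>UNIV. \<Sum>y\<in>UNIV. c x y * real (\<eta> x) * \<alpha> y * (h y - h x))
      = (\<Sum>x\<in>UNIV. real (\<eta> x) * (\<Sum>y\<in>UNIV. c x y * \<alpha> y * (h y - h x)))"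
    by (simp add: sum_distrib_left mult_ac)
  also have "\<dots> = (\<Sum>x\<in>UNIV. real (\<eta> x) * (\<omega> x * h x - l * h x))"
  proof (intro sum.cong refl arg_cong2[of _ _ _ _ "(*)"])
    show "(\<Sum>y\<in>UNIV. c x y * \<alpha> y * (h y - h x)) = \<omega> x * h x - l * h x" for x
      using eigen[of x] by linarith
  qed
  also have "\<dots> = (\<Sum>x\<in>UNIV. real (\<eta> x) * h x * \<omega> x) - l * F \<eta>"
    by (simp add: F_def algebra_simps sum_subtractf sum_distrib_left)
  finally have gen: "sip_generator c \<alpha> \<omega> F \<eta> = (\<Sum>x\<in>UNIV. real (\<eta> x) * h x * \<omega> x) - l * F \<eta>
      - F \<eta> * (\<Sum>x\<in>UNIV. \<omega> x * real (\<eta> x))"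
    by (simp add: sip_generator_def)
  have "(\<Sum>x\<in>UNIV. real (\<eta> x) * h x * \<omega> x)
      \<le> (\<Sum>x\<in>UNIV. real (\<eta> x) * h x * (\<Sum>z\<in>UNIV. \<omega> z * real (\<eta> z)))"
  proof (rule sum_mono)
    fix x
    show "real (\<eta> x) * h x * \<omega> x \<le> real (\<eta> x) * h x * (\<Sum>z\<in>UNIV. \<omega> z * real (\<eta> z))"
    proof (cases "\<eta> x = 0")
      case False
      then have "\<omega> x * 1 \<le> \<omega> x * real (\<eta> x)"
        using \<omega> by (intro mult_left_mono) auto
      also have "\<dots> \<le> (\<Sum>z\<in>UNIV. \<omega> z * real (\<eta> z))"
        using member_le_sum[of x UNIV "\<lambda>z. \<omega> z * real (\<eta> z)"] \<omega> by simp
      finally show ?thesis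
        using h[of x] by (intro mult_left_mono) auto
    qed simp
  qed
  also have "\<dots> = F \<eta> * (\<Sum>z\<in>UNIV. \<omega> z * real (\<eta> z))"
    unfolding F_def by (rule sum_distrib_right[symmetric])
  finally show ?thesis
    unfolding gen by simp
qed

text \<open>
  Maximum principle: scale \<open>F\<close> by \<open>q = Max (\<bar>g\<bar> / F)\<close>, so that \<open>q * F\<close> lies above \<open>\<bar>g\<bar>\<close> and touches
  it at some \<open>\<eta>\<close>. With \<open>e\<close> the sign of \<open>g \<eta>\<close>, the function \<open>e * g\<close> is below \<open>q * F\<close> with equality
  at \<open>\<eta>\<close>. As the jump rates are nonnegative, the generator preserves this order at the
  point of contact, and comparing \<open>- r * e * g \<eta>\<close> with \<open>- l * q * F \<eta>\<close> gives \<open>l \<le> r\<close>.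
\<close>

lemma eigenvalue_ge_of_positive_supersolution:
  fixes c :: "'v::finite \<Rightarrow> 'v \<Rightarrow> real"
  assumes c: "weighted_graph c" and \<alpha>: "\<And>x. \<alpha> x > 0"
    and F_pos: "\<And>\<eta>. \<eta> \<in> configs k \<Longrightarrow> F \<eta> > 0"
    and super: "\<And>\<eta>. \<eta> \<in> configs k \<Longrightarrow> sip_generator c \<alpha> \<omega> F \<eta> \<le> - l * F \<eta>"
    and ev: "eigenvalue_on (configs k) (\<lambda>f \<eta>. - sip_generator c \<alpha> \<omega> f \<eta>) r"
  shows "l \<le> r"
proof -
  obtain g where nz: "\<exists>\<eta>\<in>configs k. g \<eta> \<noteq> 0"
    and g: "\<And>\<eta>. \<eta> \<in> configs k \<Longrightarrow> sip_generator c \<alpha> \<omega> g \<eta> = - r * g \<eta>"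
    using ev by (force simp: eigenvalue_on_def)
  obtain \<eta> where \<eta>: "\<eta> \<in> configs k"
    and max: "\<And>\<xi>. \<xi> \<in> configs k \<Longrightarrow> \<bar>g \<xi>\<bar> / F \<xi> \<le> \<bar>g \<eta>\<bar> / F \<eta>"
  proof -
    let ?Q = "(\<lambda>\<xi>. \<bar>g \<xi>\<bar> / F \<xi>) ` configs k"
    have "finite ?Q" "?Q \<noteq> {}"
      using finite_configs nz by auto
    then have "Max ?Q \<in> ?Q" and le_Max: "\<And>v. v \<in> ?Q \<Longrightarrow> v \<le> Max ?Q"
      by auto
    then obtain \<eta> where "\<eta> \<in> configs k" "Max ?Q = \<bar>g \<eta>\<bar> / F \<eta>"
      by blast
    then show ?thesis
      using that[of \<eta>] le_Max by auto
  qed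
  define q where "q = \<bar>g \<eta>\<bar> / F \<eta>"
  define e where "e = sgn (g \<eta>)"
  have bound: "e * g \<xi> \<le> q * F \<xi>" if "\<xi> \<in> configs k" for \<xi>
  proof -
    have "e * g \<xi> \<le> \<bar>g \<xi>\<bar>"
      by (auto simp: e_def sgn_if)
    also have "\<dots> \<le> q * F \<xi>"
      using max[OF that] F_pos[OF that] by (simp add: q_def field_simps)
    finally show ?thesis .
  qed
  have touch: "e * g \<eta> = q * F \<eta>"
    using F_pos[OF \<eta>] by (simp add: e_def q_def sgn_mult_self_eq mult.commute abs_sgn)
  have q: "q > 0"
  proof -
    obtain \<xi> where "\<xi> \<in> configs k" "g \<xi> \<noteq> 0"
      using nz by blast
    then have "0 < \<bar>g \<xi>\<bar> / F \<xi>"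
      using F_pos by simp
    also have "\<dots> \<le> q"
      using max \<open>\<xi> \<in> configs k\<close> by (simp add: q_def)
    finally show ?thesis .
  qed
  have "e * sip_generator c \<alpha> \<omega> g \<eta> \<le> q * sip_generator c \<alpha> \<omega> F \<eta>"
  proof -
    let ?R = "\<lambda>x y. c x y * real (\<eta> x) * (\<alpha> y + real (\<eta> y))"
    have "?R x y * (e * g (move x y \<eta>) - e * g \<eta>) \<le> ?R x y * (q * F (move x y \<eta>) - q * F \<eta>)" for x y
    proof (cases "\<eta> x = 0")
      case False
      have "c x y \<ge> 0"
        using c by (simp add: weighted_graph_def)
      moreover have "e * g (move x y \<eta>) \<le> q * F (move x y \<eta>)"
        by (rule bound[OF move_in_configs[OF \<eta> False]])
      ultimately show ?thesis
        using touch \<alpha>[of y] by (intro mult_left_mono) auto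
    qed simp
    then have "(\<Sum>x\<in>UNIV. \<Sum>y\<in>UNIV. ?R x y * (e * g (move x y \<eta>) - e * g \<eta>))
        \<le> (\<Sum>x\<in>UNIV. \<Sum>y\<in>UNIV. ?R x y * (q * F (move x y \<eta>) - q * F \<eta>))"
      by (intro sum_mono)
    moreover have "a * sip_generator c \<alpha> \<omega> f \<eta>
        = (\<Sum>x\<in>UNIV. \<Sum>y\<in>UNIV. ?R x y * (a * f (move x y \<eta>) - a * f \<eta>))
          - a * f \<eta> * (\<Sum>x\<in>UNIV. \<omega> x * real (\<eta> x))" for a f
      by (simp add: sip_generator_def right_diff_distrib sum_distrib_left mult_ac)
    ultimately show ?thesis
      using touch by simp
  qed
  also have "\<dots> \<le> q * (- l * F \<eta>)"
    using super[OF \<eta>] q by (intro mult_left_mono) auto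
  finally have "- r * (e * g \<eta>) \<le> - l * (q * F \<eta>)"
    by (simp add: g[OF \<eta>] mult_ac)
  moreover have "q * F \<eta> > 0"
    using q F_pos[OF \<eta>] by simp
  ultimately have "l * (q * F \<eta>) \<le> r * (q * F \<eta>)" "q * F \<eta> > 0"
    by (simp_all add: touch)
  then show ?thesis
    by (rule mult_right_le_imp_le)
qed

theorem theorem6p1:
  fixes c :: "'v::finite \<Rightarrow> 'v \<Rightarrow> real" and \<alpha> \<omega> :: "'v \<Rightarrow> real"
  assumes "weighted_graph c" and "connected_graph c"
    and "\<And>x. \<alpha> x > 0"
    and "\<And>x. \<omega> x \<ge> 0"
    and "\<exists>x. \<omega> x \<noteq> 0"
  shows "gap_SIP c \<alpha> \<omega> = gap_RW c \<alpha> \<omega>"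
proof -
  obtain h where h: "\<And>x. h x > 0"
    and eigen: "\<And>x. (\<Sum>y\<in>UNIV. c x y * \<alpha> y * (h y - h x)) - \<omega> x * h x
      = - gap_RW c \<alpha> \<omega> * h x"
    using one_particle_ground_state[where \<alpha> = \<alpha> and \<omega> = \<omega>, OF assms(1-3)] by blast
  have "gap_RW c \<alpha> \<omega> \<le> gap c \<alpha> \<omega> k" if "k \<ge> 1" for k
  proof (rule eigenvalue_ge_of_positive_supersolution[where c = c and \<alpha> = \<alpha> and \<omega> = \<omega> and k = k])
    show "sip_generator c \<alpha> \<omega> (\<lambda>\<eta>. \<Sum>x\<in>UNIV. real (\<eta> x) * h x) \<eta>
        \<le> - gap_RW c \<alpha> \<omega> * (\<Sum>x\<in>UNIV. real (\<eta> x) * h x)" for \<eta>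
      using linear_statistic_superharmonic[OF assms(1,4) h eigen] .
    show "0 < (\<Sum>x\<in>UNIV. real (\<eta> x) * h x)" if "\<eta> \<in> configs k" for \<eta>
    proof -
      obtain x where "\<eta> x \<noteq> 0"
        using \<open>\<eta> \<in> configs k\<close> \<open>k \<ge> 1\<close> by (force simp: configs_def)
      then show ?thesis
        using h by (intro sum_pos2[of _ x]) (auto simp: less_imp_le)
    qed
    show "eigenvalue_on (configs k) (\<lambda>f \<eta>. - sip_generator c \<alpha> \<omega> f \<eta>) (gap c \<alpha> \<omega> k)"
      using sip_ground_state[where \<alpha> = \<alpha> and k = k and \<omega> = \<omega>, OF assms(1,3)] by blast
  qed (use assms in auto)
  then show ?thesis
    unfolding gap_SIP_def by (intro cInf_eq_minimum) (auto simp: gap_RW_def)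
qed

end
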